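(* Let $f\colon\mathbb{D}\to\mathbb{D}$ be a non-elliptic map whose Koenigs domain is not the whole complex plane. For every $z\in\mathbb{D}$ and every $\epsilon>0$, there exists a positive constant $c=c(z,\epsilon)$ such that $$1-|f^n(z)| \leq c\, n^{-\frac{1}{2+\epsilon}},\quad\text{for all } n\in\mathbb{N}.$$
   Context: $\mathbb{D}$ is the open unit disc and $\mathbb{N}=\{1,2,\dots\}$. A holomorphic map $f\colon\mathbb{D}\to\mathbb{D}$ is non-elliptic if it has no fixed point in $\mathbb{D}$; $f^n$ denotes its $n$-th iterate. A domain $\Omega\subseteq\mathbb{C}$ is starlike at infinity if $\Omega+t\subseteq\Omega$ for all $t\ge 0$; it is asymptotically starlike at infinity if $\Omega+1\subseteq\Omega$ and $\bigcup_{n=1}^\infty(\Omega-n)$ is starlike at infinity. A simply connected domain $U\subseteq\mathbb{D}$ is a fundamental domain of $f$ if $f$ is univalent on $U$, $f(U)\subseteq U$ and $\bigcup_{n\in\mathbb{N}}f^{-n}(U)=\mathbb{D}$. For a non-elliptic $f$, a Koenigs domain and a Koenigs function are a domain $\Omega$ asymptotically starlike at infinity and an onto holomorphic map $h\colon\mathbb{D}\to\Omega$ with $h\circ f=h+1$ and such that $h$ is univalent on some fundamental domain of $f$. Such a pair exists and is unique up to translation. *)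

theory Defs
  imports "HOL-Complex_Analysis.Complex_Analysis"
begin

abbreviation unit_disc :: "complex set" where
  "unit_disc \<equiv> ball 0 1"

definition complex_domain :: "complex set \<Rightarrow> bool" where
  "complex_domain \<Omega> \<longleftrightarrow> open \<Omega> \<and> connected \<Omega> \<and> \<Omega> \<noteq> {}"

definition univalent_on :: "(complex \<Rightarrow> complex) \<Rightarrow> complex set \<Rightarrow> bool" where
  "univalent_on f U \<longleftrightarrow> f holomorphic_on U \<and> inj_on f U"

definition holomorphic_self_map :: "(complex \<Rightarrow> complex) \<Rightarrow> bool" where
  "holomorphic_self_map f \<longleftrightarrow> f holomorphic_on unit_disc \<and> f ` unit_disc \<subseteq> unit_disc"

definition non_elliptic :: "(complex \<Rightarrow> complex) \<Rightarrow> bool" where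
  "non_elliptic f \<longleftrightarrow> holomorphic_self_map f \<and> (\<forall>z\<in>unit_disc. f z \<noteq> z)"

definition starlike_at_infinity :: "complex set \<Rightarrow> bool" where
  "starlike_at_infinity \<Omega> \<longleftrightarrow>
     complex_domain \<Omega> \<and> (\<forall>t::real. t \<ge> 0 \<longrightarrow> (\<lambda>w. w + of_real t) ` \<Omega> \<subseteq> \<Omega>)"

definition asymptotically_starlike_at_infinity :: "complex set \<Rightarrow> bool" where
  "asymptotically_starlike_at_infinity \<Omega> \<longleftrightarrow>
     complex_domain \<Omega> \<and> (\<lambda>w. w + 1) ` \<Omega> \<subseteq> \<Omega> \<and>
     starlike_at_infinity (\<Union>n\<in>{1::nat..}. (\<lambda>w. w - of_nat n) ` \<Omega>)"

text \<open>The map \<open>f\<close> is a total function of which only the values on the disc matter, so its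
  iterated preimages are intersected with the disc.\<close>

definition fundamental_domain :: "(complex \<Rightarrow> complex) \<Rightarrow> complex set \<Rightarrow> bool" where
  "fundamental_domain f U \<longleftrightarrow>
     complex_domain U \<and> simply_connected U \<and> U \<subseteq> unit_disc \<and>
     univalent_on f U \<and> f ` U \<subseteq> U \<and>
     (\<Union>n\<in>{1::nat..}. (f ^^ n) -` U \<inter> unit_disc) = unit_disc"

definition koenigs_pair ::
  "(complex \<Rightarrow> complex) \<Rightarrow> complex set \<Rightarrow> (complex \<Rightarrow> complex) \<Rightarrow> bool" where
  "koenigs_pair f \<Omega> h \<longleftrightarrow>
     asymptotically_starlike_at_infinity \<Omega> \<and>
     h holomorphic_on unit_disc \<and> h ` unit_disc = \<Omega> \<and>
     (\<forall>z\<in>unit_disc. h (f z) = h z + 1) \<and>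
     (\<exists>U. fundamental_domain f U \<and> univalent_on h U)"

end

theory Submission
  imports Defs
begin

text \<open>
  Since \<open>\<Omega> \<noteq> \<complex>\<close> and \<open>\<Omega> + 1 \<subseteq> \<Omega>\<close>, missing a point \<open>p\<close> forces \<open>\<Omega>\<close> to miss all of
  \<open>p, p - 1, p - 2, \<dots>\<close>; hence \<open>g = p - h\<close> omits every natural number on the disc. The theorem
  is the growth estimate \<open>\<bar>g w\<bar> = O((1 - \<bar>w\<bar>) powr -(2 + \<epsilon>))\<close> for such functions, evaluated
  along the orbit of \<open>z\<close>, where \<open>g\<close> of the \<open>n\<close>-th iterate is \<open>g z - n\<close>, of modulus about \<open>n\<close>.

  If \<open>g\<close> omitted the whole half-line \<open>[0, \<infinity>)\<close>, the Schwarz lemma applied to a square root would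
  give \<open>\<bar>g' 0\<bar> \<le> 4 \<bar>g 0\<bar>\<close>, and so growth with the Koebe exponent 2
  (\<open>norm_deriv_le_4_norm_if_omits_nonneg_Reals\<close>). Omitting only the natural numbers is almost as
  good: seen from far away they fill the half-line. After division by a large integer \<open>m\<close> the
  omitted points are \<open>k / m\<close>, which include 0 and 1, so Schottky's and Montel's theorems give
  limit functions, and these omit the half-line by Hurwitz's theorem. Hence the constant 4
  survives up to an arbitrarily small loss \<open>\<delta>\<close>, at the price of an additive constant \<open>K\<close>
  (\<open>deriv_bound_if_omits_Nats\<close>). The resulting differential inequality, made invariant under disc
  automorphisms (\<open>deriv_bound_disc_if_omits_Nats\<close>), is integrated along radii
  (\<open>growth_if_deriv_bound\<close>), and \<open>\<delta> = 2 \<epsilon>\<close> turns into the exponent \<open>2 + \<epsilon>\<close>.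
\<close>

section \<open>Functions omitting a half-line\<close>

text \<open>The complement of the half-line is mapped to the right half-plane by a branch of
  \<open>\<lambda>w. sqrt (- w)\<close>, and the half-plane to the disc by a Cayley transform, so that the Schwarz
  lemma applies. The Koebe-type function \<open>- ((1 + z) / (1 - z))\<^sup>2\<close> shows that 4 is sharp, which
  is what makes the exponent in the theorem come out right.\<close>

lemma norm_deriv_le_4_norm_if_omits_nonneg_Reals:
  assumes G: "G holomorphic_on ball 0 1"
    and omit: "\<And>z. z \<in> ball 0 1 \<Longrightarrow> G z \<notin> \<real>\<^sub>\<ge>\<^sub>0"
  shows "norm (deriv G 0) \<le> 4 * norm (G 0)"
proof -
  define s where "s z = csqrt (- G z)" for z
  define a where "a = s 0"
  have slit: "- G z \<notin> \<real>\<^sub>\<le>\<^sub>0" if "z \<in> ball 0 1" for z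
    using omit[OF that] by (simp add: complex_nonneg_Reals_iff complex_nonpos_Reals_iff)
  have Re_s: "Re (s z) > 0" if "z \<in> ball 0 1" for z
  proof -
    have "Re (s z) \<noteq> 0"
    proof
      assume "Re (s z) = 0"
      moreover have "- G z = s z ^ 2" by (simp add: s_def)
      ultimately show False
        using slit[OF that] by (simp add: complex_nonpos_Reals_iff power2_eq_square)
    qed
    then show ?thesis using Re_csqrt[of "- G z"] by (simp add: s_def)
  qed
  have hol_s: "s holomorphic_on ball 0 1"
    unfolding s_def using slit by (intro holomorphic_intros G) auto
  have Re_a: "Re a > 0" unfolding a_def by (rule Re_s) simp
  have G_deriv: "(G has_field_derivative deriv G 0) (at 0)"
    using G by (intro holomorphic_derivI) auto
  have s_deriv: "(s has_field_derivative - deriv G 0 / (2 * a)) (at 0)"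
    unfolding s_def a_def using slit[of 0]
    by (auto intro!: derivative_eq_intros G_deriv)
  have nz: "s z + cnj a \<noteq> 0" if "z \<in> ball 0 1" for z
    using Re_s[OF that] Re_a by (auto simp: complex_eq_iff)
  \<comment> \<open>the Cayley transform of the right half-plane that sends \<open>a\<close> to 0\<close>
  define \<phi> where "\<phi> z = (s z - a) / (s z + cnj a)" for z
  have phi_deriv: "(\<phi> has_field_derivative - deriv G 0 / (2 * a) / (a + cnj a)) (at 0)"
    unfolding \<phi>_def using nz[of 0]
    by (auto intro!: derivative_eq_intros s_deriv simp: a_def[symmetric] divide_simps)
  have "norm (deriv \<phi> 0) \<le> 1"
  proof (rule Schwarz_Lemma(2)[where \<xi> = 0])
    show "\<phi> holomorphic_on ball 0 1"
      unfolding \<phi>_def using nz by (intro holomorphic_intros hol_s) auto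
    show "norm (\<phi> z) < 1" if "norm z < 1" for z
    proof -
      have "Re (s z) > 0" using Re_s that by simp
      then have "(norm (s z - a))\<^sup>2 < (norm (s z + cnj a))\<^sup>2"
        using Re_a mult_pos_pos[of "Re (s z)" "Re a"]
        unfolding cmod_power2 by (simp add: power2_eq_square algebra_simps)
      then have "norm (s z - a) < norm (s z + cnj a)"
        by (simp add: power2_less_imp_less)
      then show ?thesis using nz[of z] that by (simp add: \<phi>_def norm_divide)
    qed
  qed (auto simp: \<phi>_def a_def)
  then have "norm (deriv G 0) \<le> 2 * norm a * norm (a + cnj a)"
    using DERIV_imp_deriv[OF phi_deriv] Re_a nz[of 0]
    by (auto simp: norm_divide norm_mult divide_simps a_def split: if_splits)
  also have "\<dots> = 4 * norm a * Re a"
    using Re_a by (simp add: complex_add_cnj norm_mult)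
  also have "\<dots> \<le> 4 * norm a * norm a"
    by (intro mult_left_mono complex_Re_le_cmod) auto
  also have "\<dots> = 4 * norm (G 0)"
    by (metis (no_types) a_def mult.assoc norm_minus_cancel norm_mult power2_csqrt power2_eq_square s_def)
  finally show ?thesis .
qed

section \<open>Functions omitting the natural numbers\<close>

text \<open>Schottky's theorem, transferred from the closed to the open disc by a dilation with factor
  halfway between \<open>t\<close> and 1. Its role is to supply the local boundedness for Montel's theorem.\<close>

lemma norm_le_if_omits_0_1:
  assumes hol: "g holomorphic_on ball 0 1"
    and omit: "\<And>z. z \<in> ball 0 1 \<Longrightarrow> g z \<noteq> 0 \<and> g z \<noteq> 1"
    and "norm (g 0) \<le> 1" "0 < t" "t < 1" "norm z \<le> t"
  shows "norm (g z) \<le> exp (pi * exp (pi * (4 + 24 * t / (1 - t))))"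
proof -
  define \<rho> where "\<rho> = (1 + t) / 2"
  have rho: "0 < \<rho>" "\<rho> < 1" "t < \<rho>" using assms by (auto simp: \<rho>_def)
  have sub: "of_real \<rho> * w \<in> ball 0 1" if "w \<in> cball 0 1" for w :: complex
  proof -
    have "\<rho> * norm w \<le> \<rho>" using that rho by (intro mult_left_le) auto
    then have "\<rho> * norm w < 1" using rho by linarith
    then show ?thesis using rho by (simp add: norm_mult)
  qed
  have "norm (g (of_real \<rho> * (z / of_real \<rho>)))
      \<le> exp (pi * exp (pi * (2 + 2 * 1 + 12 * (t / \<rho>) / (1 - t / \<rho>))))"
  proof (rule Schottky[where f = "\<lambda>w. g (of_real \<rho> * w)"])
    have "g \<circ> (\<lambda>w. of_real \<rho> * w) holomorphic_on cball 0 1"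
      using sub by (intro holomorphic_on_compose_gen[OF _ hol] holomorphic_intros) auto
    then show "(\<lambda>w. g (of_real \<rho> * w)) holomorphic_on cball 0 1"
      by (simp add: o_def)
  qed (use sub omit assms rho in \<open>auto simp: norm_divide divide_simps\<close>)
  moreover have "12 * (t / \<rho>) / (1 - t / \<rho>) = 24 * t / (1 - t)"
  proof -
    have "1 - t / \<rho> = (\<rho> - t) / \<rho>" using rho by (simp add: diff_divide_distrib)
    moreover have "\<rho> - t = (1 - t) / 2" by (simp add: \<rho>_def field_simps)
    ultimately show ?thesis using rho by simp
  qed
  ultimately show ?thesis using rho by simp
qed

text \<open>A compactness argument. Functions \<open>g j\<close> violating the bound with \<open>K = j + 2\<close> are rescaled by
  integers \<open>m j\<close> slightly above \<open>\<bar>g j 0\<bar> + j\<close>. The summand \<open>j\<close> forces the scales to infinity even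
  when the values \<open>g j 0\<close> stay bounded, so a single limit argument covers both regimes. The limit
  \<open>G\<close> has \<open>\<bar>G 0\<bar> \<le> 1\<close> and \<open>\<bar>G' 0\<bar> \<ge> 4 + \<delta>\<close>, but omits the half-line.\<close>

lemma deriv_bound_if_omits_Nats:
  assumes "\<delta> > (0::real)"
  obtains K where "K > 0"
    "\<And>g. \<lbrakk>g holomorphic_on ball 0 1; \<And>z. z \<in> ball 0 1 \<Longrightarrow> g z \<notin> \<nat>\<rbrakk>
      \<Longrightarrow> norm (deriv g 0) \<le> (4 + \<delta>) * (norm (g 0) + K)"
proof (rule ccontr)
  assume "\<not> thesis"
  with that have "\<exists>g. g holomorphic_on ball 0 1 \<and> (\<forall>z\<in>ball 0 1. g z \<notin> \<nat>) \<and>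
      norm (deriv g 0) > (4 + \<delta>) * (norm (g 0) + K)" if "K > 0" for K
    using that by (metis not_le)
  then have "\<forall>j::nat. \<exists>g. g holomorphic_on ball 0 1 \<and> (\<forall>z\<in>ball 0 1. g z \<notin> \<nat>) \<and>
      norm (deriv g 0) > (4 + \<delta>) * (norm (g 0) + (real j + 2))"
    by simp
  then obtain g where hol_g: "\<And>j::nat. g j holomorphic_on ball 0 1"
    and omit_g: "\<And>j z. z \<in> ball 0 1 \<Longrightarrow> g j z \<notin> \<nat>"
    and deriv_g: "\<And>j. norm (deriv (g j) 0) > (4 + \<delta>) * (norm (g j 0) + (real j + 2))"
    by metis
  \<comment> \<open>integer scales, so that 1 is among the omitted values \<open>k / m j\<close>\<close>
  define m where "m j = nat \<lceil>norm (g j 0) + real j + 1\<rceil>" for j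
  have m: "norm (g j 0) + real j + 1 \<le> real (m j)" "real (m j) \<le> norm (g j 0) + real j + 2"
    for j unfolding m_def using norm_ge_zero[of "g j 0"] by linarith+
  have m_pos: "real (m j) > 0" for j using m(1)[of j] norm_ge_zero[of "g j 0"] by linarith
  define H where "H j z = g j z / of_nat (m j)" for j z
  have hol_H: "H j holomorphic_on ball 0 1" for j
    unfolding H_def using m_pos[of j] by (intro holomorphic_intros hol_g) auto
  have omit_H: "H j z \<noteq> of_nat k / of_nat (m j)" if "z \<in> ball 0 1" for j k z
    using omit_g[OF that, of j] m_pos[of j] by (auto simp: H_def)
  have H0: "norm (H j 0) \<le> 1" for j
    using m(1)[of j] m_pos[of j] by (simp add: H_def norm_divide divide_simps)
  have deriv_H: "norm (deriv (H j) 0) \<ge> 4 + \<delta>" for j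
  proof -
    have "(4 + \<delta>) * real (m j) \<le> (4 + \<delta>) * (norm (g j 0) + (real j + 2))"
      using m(2)[of j] assms by (intro mult_left_mono) auto
    also have "\<dots> < norm (deriv (g j) 0)" by (rule deriv_g)
    finally have "(4 + \<delta>) * real (m j) \<le> norm (deriv (g j) 0)" by simp
    moreover have "deriv (H j) 0 = deriv (g j) 0 / of_nat (m j)"
      unfolding H_def using hol_g[of j]
      by (intro DERIV_imp_deriv DERIV_cdivide holomorphic_derivI) auto
    ultimately show ?thesis
      using m_pos[of j] by (simp add: norm_divide pos_le_divide_eq del: of_nat_0_less_iff)
  qed
  obtain G r where hol_G: "G holomorphic_on ball 0 1" and r: "strict_mono (r :: nat \<Rightarrow> nat)"
    and pw: "\<And>x. x \<in> ball 0 1 \<Longrightarrow> (\<lambda>n. H (r n) x) \<longlonglongrightarrow> G x"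
    and ul: "\<And>K. \<lbrakk>compact K; K \<subseteq> ball 0 1\<rbrakk> \<Longrightarrow> uniform_limit K (H \<circ> r) G sequentially"
  proof (rule Montel[of "ball 0 1" "range H" H])
    fix K :: "complex set" assume K: "compact K" "K \<subseteq> ball 0 1"
    obtain t where t: "0 < t" "t < 1" "K \<subseteq> cball 0 t"
    proof (cases "K = {}")
      case False
      then obtain x where x: "x \<in> K" "\<And>y. y \<in> K \<Longrightarrow> norm y \<le> norm x"
        using continuous_attains_sup[OF K(1), of norm] continuous_on_norm_id by blast
      have "norm x < 1" using x(1) K(2) by auto
      moreover have "norm y \<le> (1 + norm x) / 2" if "y \<in> K" for y
        using x(2)[OF that] \<open>norm x < 1\<close> by simp
      ultimately show ?thesis
        by (intro that[of "(1 + norm x) / 2"]) (auto intro: add_pos_nonneg)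
    qed (use that[of "1/2"] in auto)
    have "norm (h z) \<le> exp (pi * exp (pi * (4 + 24 * t / (1 - t))))"
      if h_in: "h \<in> range H" and z: "z \<in> K" for h z
    proof -
      obtain j where h: "h = H j" using h_in by auto
      have "H j w \<noteq> 0 \<and> H j w \<noteq> 1" if "w \<in> ball 0 1" for w
        using omit_H[OF that, of j 0] omit_H[OF that, of j "m j"] m_pos[of j] by auto
      then show ?thesis unfolding h
        using t z by (intro norm_le_if_omits_0_1 hol_H H0) auto
    qed
    then show "\<exists>B. \<forall>h\<in>range H. \<forall>z\<in>K. norm (h z) \<le> B" by blast
  qed (use hol_H in auto)
  have ball_half: "uniform_limit (ball 0 (1/2)) (H \<circ> r) G sequentially"
    by (rule uniform_limit_on_subset[OF ul[of "cball 0 (1/2)"]]) auto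
  have "(\<lambda>n. deriv ((H \<circ> r) n) 0) \<longlonglongrightarrow> deriv G 0"
    by (rule deriv_complex_uniform_limit[OF ball_half])
      (auto intro!: always_eventually holomorphic_on_subset[OF hol_H])
  then have deriv_G: "norm (deriv G 0) \<ge> 4 + \<delta>"
    using deriv_H by (intro tendsto_lowerbound[OF tendsto_norm]) (auto intro!: always_eventually)
  have G0: "norm (G 0) \<le> 1"
    using H0 by (intro tendsto_upperbound[OF tendsto_norm[OF pw]]) (auto intro!: always_eventually)
  have "\<not> G constant_on ball 0 1"
  proof
    assume "G constant_on ball 0 1"
    then obtain c where c: "\<And>z. z \<in> ball 0 1 \<Longrightarrow> G z = c" by (auto simp: constant_on_def)
    have "(G has_field_derivative 0) (at 0)"
      by (rule has_field_derivative_transform_within_open[of "\<lambda>_. c" _ _ "ball 0 1"]) (auto simp: c)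
    then show False using deriv_G assms by (simp add: DERIV_imp_deriv)
  qed
  have "G z \<notin> \<real>\<^sub>\<ge>\<^sub>0" if z: "z \<in> ball 0 1" for z
  proof
    assume "G z \<in> \<real>\<^sub>\<ge>\<^sub>0"
    then obtain x where x: "x \<ge> 0" "G z = of_real x" by (auto elim: nonneg_Reals_cases)
    \<comment> \<open>The omitted values \<open>q n\<close> of the rescaled functions approach \<open>x\<close>; by Hurwitz's theorem the
        nonconstant limit cannot attain \<open>x\<close>.\<close>
    define M where "M n = real (m (r n))" for n
    define q where "q n = real (nat \<lfloor>x * M n\<rfloor>) / M n" for n
    have M: "M n > 0" "M n \<ge> real n" for n
    proof -
      have "real n \<le> real (r n)" using seq_suble[OF r, of n] by simp
      then show "M n > 0" "M n \<ge> real n"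
        using m(1)[of "r n"] norm_ge_zero[of "g (r n) 0"] unfolding M_def by linarith+
    qed
    have M_lim: "filterlim M at_top sequentially"
      by (rule filterlim_at_top_mono[OF filterlim_real_sequentially]) (use M in auto)
    have q_near: "norm (q n - x) \<le> 1 / M n" for n
    proof -
      have "x * M n \<ge> 0" using x M[of n] by simp
      then have "\<bar>real (nat \<lfloor>x * M n\<rfloor>) - x * M n\<bar> \<le> 1" by linarith
      then show ?thesis using M[of n] by (simp add: q_def divide_simps abs_if split: if_splits)
    qed
    have q_lim: "q \<longlonglongrightarrow> x"
    proof (rule LIM_zero_cancel, rule Lim_null_comparison)
      show "\<forall>\<^sub>F n in sequentially. norm (q n - x) \<le> 1 / M n" using q_near by simp
      show "(\<lambda>n. 1 / M n) \<longlonglongrightarrow> 0"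
        by (intro real_tendsto_divide_at_top[OF tendsto_const M_lim])
    qed
    have "G z - of_real x \<noteq> 0"
    proof (rule Hurwitz_no_zeros[where S = "ball 0 1" and ?z0.0 = z
          and \<F> = "\<lambda>n w. H (r n) w - of_real (q n)" and g = "\<lambda>w. G w - of_real x"])
      show "uniform_limit K (\<lambda>n w. H (r n) w - of_real (q n)) (\<lambda>w. G w - of_real x) sequentially"
        if "compact K" "K \<subseteq> ball 0 1" for K
      proof (rule uniform_limit_minus)
        show "uniform_limit K (\<lambda>n. H (r n)) G sequentially" using ul[OF that] by (simp add: o_def)
        show "uniform_limit K (\<lambda>n w. of_real (q n)) (\<lambda>w. complex_of_real x) sequentially"
          by (rule uniform_limitI) (use tendstoD[OF q_lim] in \<open>auto elim: eventually_mono\<close>)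
      qed
      show "\<not> (\<lambda>w. G w - of_real x) constant_on ball 0 1"
        using \<open>\<not> G constant_on ball 0 1\<close> unfolding constant_on_def by (metis diff_add_cancel)
      show "H (r n) w - of_real (q n) \<noteq> 0" if "w \<in> ball 0 1" for n w
        using omit_H[OF that, of "r n" "nat \<lfloor>x * M n\<rfloor>"] by (simp add: q_def M_def)
    qed (use z in \<open>auto intro!: holomorphic_intros hol_H hol_G\<close>)
    then show False using x by simp
  qed
  then have "norm (deriv G 0) \<le> 4 * norm (G 0)"
    by (rule norm_deriv_le_4_norm_if_omits_nonneg_Reals[OF hol_G])
  with deriv_G G0 assms show False by simp
qed

text \<open>Precomposition with a disc automorphism preserves the omitted values, so a bound at the
  origin for the whole class is a bound at every point, with the hyperbolic factor
  \<open>1 - \<bar>z\<bar>\<^sup>2\<close>. The exponent 2 depends on this factor: using the largest disc around \<open>z\<close> in place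
  of an automorphism would only give \<open>1 - \<bar>z\<bar>\<close>, and would double the exponent.\<close>

lemma deriv_bound_disc_if_omits_Nats:
  assumes bound: "\<And>g. \<lbrakk>g holomorphic_on ball 0 1; \<And>z. z \<in> ball 0 1 \<Longrightarrow> g z \<notin> \<nat>\<rbrakk>
      \<Longrightarrow> norm (deriv g 0) \<le> C * (norm (g 0) + K)"
    and hol: "g holomorphic_on ball 0 1"
    and omit: "\<And>z. z \<in> ball 0 1 \<Longrightarrow> g z \<notin> \<nat>"
    and z: "z \<in> ball 0 1"
  shows "(1 - (norm z)\<^sup>2) * norm (deriv g z) \<le> C * (norm (g z) + K)"
proof -
  let ?\<mu> = "Moebius_function 0 (- z)"
  have mu_ball: "?\<mu> w \<in> ball 0 1" if "w \<in> ball 0 1" for w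
    using Moebius_function_norm_lt_1[of "-z" w 0] z that by simp
  have mu0: "?\<mu> 0 = z" by (simp add: Moebius_function_simple)
  have "(?\<mu> has_field_derivative (1 - cnj z * z)) (at 0)"
    unfolding Moebius_function_simple by (auto intro!: derivative_eq_intros)
  moreover have "(g has_field_derivative deriv g z) (at z)"
    using hol z by (intro holomorphic_derivI) auto
  ultimately have "(g \<circ> ?\<mu> has_field_derivative deriv g z * (1 - cnj z * z)) (at 0)"
    by (intro DERIV_chain) (simp_all add: mu0)
  then have "norm (deriv (g \<circ> ?\<mu>) 0) = norm (deriv g z) * norm (1 - cnj z * z)"
    by (simp add: DERIV_imp_deriv norm_mult)
  also have "1 - cnj z * z = of_real (1 - (norm z)\<^sup>2)"
    by (metis complex_norm_square mult.commute of_real_1 of_real_diff of_real_power)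
  also have "norm (complex_of_real (1 - (norm z)\<^sup>2)) = 1 - (norm z)\<^sup>2"
    using z by (subst norm_of_real) (simp add: abs_square_le_1)
  finally have "norm (deriv (g \<circ> ?\<mu>) 0) = (1 - (norm z)\<^sup>2) * norm (deriv g z)"
    by (simp only: mult.commute)
  moreover have "norm (deriv (g \<circ> ?\<mu>) 0) \<le> C * (norm ((g \<circ> ?\<mu>) 0) + K)"
    using z mu_ball omit
    by (intro bound holomorphic_on_compose_gen[OF _ hol] Moebius_function_holomorphic) auto
  ultimately show ?thesis by (simp only: mu0 o_apply)
qed

section \<open>Integrating the derivative bound\<close>

text \<open>A Gronwall argument along the radius through \<open>z\<close>: the logarithmic derivative of
  \<open>\<bar>g\<bar> + K\<close> is at most \<open>2 C / (1 - t\<^sup>2)\<close>, the derivative of \<open>C * ln ((1 + t) / (1 - t))\<close>. Zeros of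
  \<open>g\<close> are excluded so that \<open>\<bar>g\<bar>\<close> is differentiable.\<close>

lemma growth_if_deriv_bound:
  assumes hol: "g holomorphic_on ball 0 1"
    and nz: "\<And>z. z \<in> ball 0 1 \<Longrightarrow> g z \<noteq> 0"
    and "K > 0" "C \<ge> 0"
    and bound: "\<And>z. z \<in> ball 0 1 \<Longrightarrow> (1 - (norm z)\<^sup>2) * norm (deriv g z) \<le> 2 * C * (norm (g z) + K)"
    and z: "z \<in> ball 0 1"
  shows "norm (g z) + K \<le> (norm (g 0) + K) * (2 / (1 - norm z)) powr C"
proof -
  define r where "r = norm z"
  \<comment> \<open>\<open>sgn 0 = 0\<close>, so only \<open>norm \<zeta> \<le> 1\<close> holds in general; this suffices below\<close>
  define \<zeta> where "\<zeta> = sgn z"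
  have r: "0 \<le> r" "r < 1" using z by (auto simp: r_def)
  have zeta: "norm \<zeta> \<le> 1" by (simp add: \<zeta>_def norm_sgn)
  have z_eq: "z = of_real r * \<zeta>" by (simp add: r_def \<zeta>_def sgn_eq)
  have in_ball: "of_real t * \<zeta> \<in> ball 0 1" and norm_le: "norm (of_real t * \<zeta>) \<le> t"
    if "0 \<le> t" "t \<le> r" for t
    using that r zeta mult_left_le[of "norm \<zeta>" t] by (auto simp: norm_mult)
  define u where "u t = norm (g (of_real t * \<zeta>)) + K" for t
  define v where "v t = ln (u t) - C * (ln (1 + t) - ln (1 - t))" for t
  have u_pos: "u t > 0" for t using \<open>K > 0\<close> by (simp add: u_def add_nonneg_pos)
  have "v r \<le> v 0"
  proof (rule DERIV_nonpos_imp_nonincreasing[OF r(1)])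
    fix t assume t: "0 \<le> t" "t \<le> r"
    define w where "w = of_real t * \<zeta>"
    have w: "w \<in> ball 0 1" "norm w \<le> t" using in_ball norm_le t by (auto simp: w_def)
    have "((\<lambda>t. g (of_real t * \<zeta>)) has_vector_derivative \<zeta> * deriv g w) (at t)"
    proof -
      have "((\<lambda>t. of_real t * \<zeta>) has_vector_derivative \<zeta>) (at t)"
        by (auto intro!: derivative_eq_intros)
      moreover have "(g has_field_derivative deriv g w) (at (of_real t * \<zeta>))"
        using holomorphic_derivI[OF hol _ w(1)] by (simp add: w_def)
      ultimately show ?thesis by (auto dest: field_vector_diff_chain_at simp: o_def)
    qed
    then have "((\<lambda>t. norm (g (of_real t * \<zeta>))) has_derivative
        (\<lambda>h. inner (h *\<^sub>R (\<zeta> * deriv g w)) (sgn (g w)))) (at t)"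
      using has_derivative_norm[OF nz[OF w(1)]] unfolding has_vector_derivative_def w_def
      by (rule has_derivative_compose[where g = norm])
    then have du: "(u has_real_derivative inner (\<zeta> * deriv g w) (sgn (g w))) (at t)"
      (is "(_ has_real_derivative ?D) _")
      unfolding u_def has_field_derivative_def
      by (auto intro!: derivative_eq_intros simp: fun_eq_iff)
    have "?D \<le> norm (\<zeta> * deriv g w) * norm (sgn (g w))" by (rule norm_cauchy_schwarz)
    also have "\<dots> \<le> norm (deriv g w)"
      using zeta nz[OF w(1)] by (simp add: norm_mult norm_sgn mult_left_le_one_le)
    finally have D: "?D \<le> norm (deriv g w)" .
    have "(1 - t\<^sup>2) * norm (deriv g w) \<le> (1 - (norm w)\<^sup>2) * norm (deriv g w)"
      using w by (intro mult_right_mono) (auto simp: power_mono)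
    also have "\<dots> \<le> 2 * C * u t" using bound[OF w(1)] by (simp add: u_def w_def)
    finally have key: "(1 - t\<^sup>2) * norm (deriv g w) \<le> 2 * C * u t" .
    have t1: "1 - t > 0" "1 + t > 0" "1 - t\<^sup>2 > 0"
      using t r by (auto simp: abs_square_less_1)
    have "(v has_real_derivative ?D / u t - C * (1 / (1 + t) + 1 / (1 - t))) (at t)"
      unfolding v_def using t1 u_pos[of t]
      by (auto intro!: derivative_eq_intros du simp: divide_simps)
    moreover have "?D / u t - C * (1 / (1 + t) + 1 / (1 - t)) \<le> 0"
    proof -
      have "?D * (1 - t\<^sup>2) \<le> 2 * C * u t"
        using order_trans[OF mult_left_mono[OF D] key] t1 by (simp add: mult.commute)
      then have "?D / u t \<le> 2 * C / (1 - t\<^sup>2)"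
        using t1 u_pos[of t] by (simp add: divide_simps mult.commute)
      moreover have "1 / (1 + t) + 1 / (1 - t) = 2 / (1 - t\<^sup>2)"
        using t1 by (simp add: field_simps power2_eq_square)
      ultimately show ?thesis by (simp add: mult.commute)
    qed
    ultimately show "\<exists>y. (v has_real_derivative y) (at t) \<and> y \<le> 0" by blast
  qed
  then have "ln (u r) \<le> ln (u 0) + C * ln ((1 + r) / (1 - r))"
    using r by (simp add: v_def ln_div)
  also have "\<dots> \<le> ln (u 0) + C * ln (2 / (1 - r))"
    using r \<open>C \<ge> 0\<close> by (intro add_left_mono mult_left_mono ln_mono) (auto simp: divide_simps)
  also have "\<dots> = ln (u 0 * (2 / (1 - r)) powr C)"
    using r u_pos[of 0] by (simp add: ln_mult ln_powr)
  finally have "u r \<le> u 0 * (2 / (1 - r)) powr C"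
    using u_pos[of r] u_pos[of 0] r by (subst (asm) ln_le_cancel_iff) auto
  moreover have "u r = norm (g z) + K" by (simp only: u_def z_eq[symmetric])
  ultimately show ?thesis by (simp add: u_def r_def)
qed

section \<open>The rate of convergence of orbits\<close>

theorem mainTheorem6:
  fixes f h :: "complex \<Rightarrow> complex" and \<Omega> :: "complex set"
  assumes "non_elliptic f"
    and "koenigs_pair f \<Omega> h"
    and "\<Omega> \<noteq> UNIV"
  shows "\<forall>z\<in>unit_disc. \<forall>\<epsilon>::real. \<epsilon> > 0 \<longrightarrow>
    (\<exists>c::real. c > 0 \<and>
      (\<forall>n::nat. n \<ge> 1 \<longrightarrow> 1 - cmod ((f ^^ n) z) \<le> c * real n powr (- (1 / (2 + \<epsilon>)))))"
proof (intro ballI allI impI)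
  fix z :: complex and \<epsilon> :: real
  assume z: "z \<in> unit_disc" and "\<epsilon> > 0"
  have f_disc: "f w \<in> unit_disc" if "w \<in> unit_disc" for w
    using assms(1) that unfolding non_elliptic_def holomorphic_self_map_def by blast
  have hol_h: "h holomorphic_on unit_disc" and im_h: "h ` unit_disc = \<Omega>"
    and h_f: "\<And>w. w \<in> unit_disc \<Longrightarrow> h (f w) = h w + 1"
    and shift: "(\<lambda>w. w + 1) ` \<Omega> \<subseteq> \<Omega>"
    using assms(2) by (auto simp: koenigs_pair_def asymptotically_starlike_at_infinity_def)
  obtain p where p: "p \<notin> \<Omega>" using assms(3) by auto
  have shift_nat: "w + of_nat k \<in> \<Omega>" if "w \<in> \<Omega>" for w and k :: nat
  proof (induction k)
    case (Suc k)
    then have "(w + of_nat k) + 1 \<in> \<Omega>" using shift by blast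
    then show ?case by (simp add: add_ac)
  qed (use that in simp)
  \<comment> \<open>the sign turns the omitted values \<open>p - k\<close> of \<open>h\<close> into the natural numbers\<close>
  define g where "g w = p - h w" for w
  have hol_g: "g holomorphic_on unit_disc"
    unfolding g_def by (intro holomorphic_intros hol_h)
  have omit: "g w \<notin> \<nat>" if "w \<in> unit_disc" for w
  proof
    assume "g w \<in> \<nat>"
    then obtain k where "p = h w + of_nat k" by (auto simp: g_def Nats_def algebra_simps)
    then show False using shift_nat[of "h w" k] p im_h that by auto
  qed
  have orbit: "(f ^^ n) z \<in> unit_disc \<and> g ((f ^^ n) z) = g z - of_nat n" for n
    by (induction n) (use z f_disc h_f in \<open>auto simp: g_def\<close>)
  obtain K where K: "K > 0" and
    bound: "\<And>g. \<lbrakk>g holomorphic_on ball 0 1; \<And>z. z \<in> ball 0 1 \<Longrightarrow> g z \<notin> \<nat>\<rbrakk>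
      \<Longrightarrow> norm (deriv g 0) \<le> (4 + 2 * \<epsilon>) * (norm (g 0) + K)"
    using deriv_bound_if_omits_Nats[of "2 * \<epsilon>"] \<open>\<epsilon> > 0\<close> by auto
  define C where "C = 2 + \<epsilon>"
  define A where "A = (norm (g z) + norm (g 0) + K) * 2 powr C"
  have C: "C > 0" using \<open>\<epsilon> > 0\<close> by (simp add: C_def)
  have A: "A > 0" using K by (simp add: A_def add_nonneg_pos)
  have growth: "norm (g w) + K \<le> (norm (g 0) + K) * (2 / (1 - norm w)) powr C"
    if "w \<in> unit_disc" for w
  proof (rule growth_if_deriv_bound[OF hol_g _ K _ _ that])
    show "g w \<noteq> 0" if "w \<in> unit_disc" for w
      using omit[OF that] by (metis Nats_0)
    show "(1 - (norm w)\<^sup>2) * norm (deriv g w) \<le> 2 * C * (norm (g w) + K)"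
      if "w \<in> unit_disc" for w
      using deriv_bound_disc_if_omits_Nats[OF bound hol_g omit that] by (simp add: C_def)
  qed (use C in simp)
  have "1 - cmod ((f ^^ n) z) \<le> A powr (1 / C) * real n powr (- (1 / C))" if "n \<ge> 1" for n
  proof -
    define d where "d = 1 - cmod ((f ^^ n) z)"
    have d: "0 < d" "d \<le> 1" using orbit[of n] by (auto simp: d_def)
    \<comment> \<open>\<open>2 / d \<ge> 1\<close> lets the constant \<open>norm (g z)\<close> be absorbed into the growth term\<close>
    have "1 \<le> 2 / d" using d by simp
    then have ge1: "1 \<le> (2 / d) powr C" using C by (intro ge_one_powr_ge_zero) auto
    have "real n = norm (g z - g ((f ^^ n) z))" using orbit[of n] by simp
    also have "\<dots> \<le> norm (g z) + norm (g ((f ^^ n) z))" by (rule norm_triangle_ineq4)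
    also have "\<dots> \<le> norm (g z) * (2 / d) powr C + (norm (g 0) + K) * (2 / d) powr C"
      using growth[of "(f ^^ n) z"] orbit[of n] K mult_left_mono[OF ge1, of "norm (g z)"]
      by (simp add: d_def)
    also have "\<dots> = A * d powr (- C)"
      using d by (simp add: A_def powr_divide powr_minus_divide algebra_simps add_divide_distrib)
    finally have "real n * d powr C \<le> A"
      using d by (simp add: powr_minus field_simps)
    then have "(real n * d powr C) powr (1 / C) \<le> A powr (1 / C)"
      using C that by (intro powr_mono2) auto
    then have "real n powr (1 / C) * d \<le> A powr (1 / C)"
      using C d that by (simp add: powr_mult powr_powr)
    then show ?thesis
      using that by (simp add: d_def[symmetric] powr_minus field_simps)
  qed
  then show "\<exists>c::real. c > 0 \<and> (\<forall>n::nat. n \<ge> 1 \<longrightarrow>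
      1 - cmod ((f ^^ n) z) \<le> c * real n powr (- (1 / (2 + \<epsilon>))))"
    using A by (intro exI[of _ "A powr (1 / C)"]) (auto simp: C_def)
qed

end
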